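(* Let $C$ be a non-trivial (i.e. $|C|\geq 2$) neighbour-transitive code in the odd graph $K(2k+1,k)=O_{k+1}$ with minimum distance $\delta$, and suppose that $\mathrm{Aut}(C)$ acts transitively but imprimitively on $\Omega$ with system of imprimitivity $\{B_1,\ldots,B_a\}$, where $|B_i|=b$ for each $i$ and $ab=2k+1$ with $a,b\geq 2$. For each $\alpha\subseteq\Omega$ let $\iota(\alpha)$ be the multiset $\{|\alpha\cap B_i|\mid i=1,\ldots,a\}$. Then one of the following holds. (1) $\delta\geq 2$ and there exist integers $a_0,a_1,b_1$ such that $\iota(\alpha)=\{b^{a_0},b_1^{a_1}\}$ for all $\alpha\in C$. (2) $\delta=1$ and $\iota(\alpha)=\{(\tfrac{b-1}{2})^{(a+1)/2},(\tfrac{b+1}{2})^{(a-1)/2}\}$ for all $\alpha\in C$. (3) $\delta=1$ and $\iota(\alpha)=\{0^{(a-1)/2},\tfrac{b-1}{2},b^{(a-1)/2}\}$ for all $\alpha\in C$. Moreover, for each of the cases (1), (2), (3) there exists an infinite family of such codes satisfying that case.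
   Context: Let $k\geq 2$ and let $\Omega$ be a set with $|\Omega|=2k+1$. The odd graph $O_{k+1}=K(2k+1,k)$ has as vertices the $k$-subsets of $\Omega$, two vertices being adjacent iff they are disjoint; its automorphism group is $\mathrm{Sym}(\Omega)$. A code $C$ is a set of vertices. Writing $d$ for graph distance, the minimum distance $\delta$ of $C$ is the least distance between two distinct codewords; $C_1$ is the set of vertices $\gamma$ with $\min_{\alpha\in C} d(\alpha,\gamma)=1$. $\mathrm{Aut}(C)$ is the setwise stabiliser of $C$ in $\mathrm{Sym}(\Omega)$. $C$ is neighbour-transitive if $C_1\neq\emptyset$ and $\mathrm{Aut}(C)$ is transitive on both $C$ and $C_1$. Multiset notation: $\{c_1^{m_1},\ldots,c_s^{m_s}\}$ denotes the multiset containing $c_j$ with multiplicity $m_j$. *)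

theory Defs
  imports "HOL-Combinatorics.Permutations" "HOL-Library.Disjoint_Sets"
    "HOL-Library.Extended_Nat" "HOL-Library.Multiset"
begin

definition graph_dist :: "('v \<times> 'v) set \<Rightarrow> 'v \<Rightarrow> 'v \<Rightarrow> enat" where
  "graph_dist E u v = (INF n\<in>{n. (u, v) \<in> E ^^ n}. enat n)"

definition kneser_verts :: "'a set \<Rightarrow> nat \<Rightarrow> 'a set set" where
  "kneser_verts \<Omega> k = {\<alpha>. \<alpha> \<subseteq> \<Omega> \<and> card \<alpha> = k}"

definition kneser_edges :: "'a set \<Rightarrow> nat \<Rightarrow> ('a set \<times> 'a set) set" where
  "kneser_edges \<Omega> k =
    {(\<alpha>, \<beta>). \<alpha> \<in> kneser_verts \<Omega> k \<and> \<beta> \<in> kneser_verts \<Omega> k \<and> \<alpha> \<inter> \<beta> = {}}"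

definition min_distance :: "'a set \<Rightarrow> nat \<Rightarrow> 'a set set \<Rightarrow> enat" where
  "min_distance \<Omega> k C =
    (INF (\<alpha>, \<beta>)\<in>{(\<alpha>, \<beta>). \<alpha> \<in> C \<and> \<beta> \<in> C \<and> \<alpha> \<noteq> \<beta>}.
       graph_dist (kneser_edges \<Omega> k) \<alpha> \<beta>)"

definition code_neighbours :: "'a set \<Rightarrow> nat \<Rightarrow> 'a set set \<Rightarrow> 'a set set" where
  "code_neighbours \<Omega> k C =
    {\<gamma> \<in> kneser_verts \<Omega> k. (INF \<alpha>\<in>C. graph_dist (kneser_edges \<Omega> k) \<alpha> \<gamma>) = 1}"

definition code_aut :: "'a set \<Rightarrow> 'a set set \<Rightarrow> ('a \<Rightarrow> 'a) set" where
  "code_aut \<Omega> C = {g. g permutes \<Omega> \<and> (`) g ` C = C}"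

definition transitive_on :: "('g \<Rightarrow> 'x \<Rightarrow> 'x) \<Rightarrow> 'g set \<Rightarrow> 'x set \<Rightarrow> bool" where
  "transitive_on act G X \<longleftrightarrow> (\<forall>x\<in>X. \<forall>y\<in>X. \<exists>g\<in>G. act g x = y)"

definition neighbour_transitive :: "'a set \<Rightarrow> nat \<Rightarrow> 'a set set \<Rightarrow> bool" where
  "neighbour_transitive \<Omega> k C \<longleftrightarrow>
    code_neighbours \<Omega> k C \<noteq> {} \<and>
    transitive_on (`) (code_aut \<Omega> C) C \<and>
    transitive_on (`) (code_aut \<Omega> C) (code_neighbours \<Omega> k C)"

text \<open>An invariant partition of \<open>\<Omega>\<close> into \<open>a\<close> blocks of size \<open>b\<close>;
  the bounds on \<open>a\<close> and \<open>b\<close> exclude the two trivial partitions.\<close>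

definition imprimitivity_system ::
    "('a \<Rightarrow> 'a) set \<Rightarrow> 'a set \<Rightarrow> nat \<Rightarrow> nat \<Rightarrow> 'a set set \<Rightarrow> bool" where
  "imprimitivity_system G \<Omega> a b \<B> \<longleftrightarrow>
    partition_on \<Omega> \<B> \<and> (\<forall>g\<in>G. \<forall>B\<in>\<B>. g ` B \<in> \<B>) \<and>
    card \<B> = a \<and> (\<forall>B\<in>\<B>. card B = b) \<and> a \<ge> 2 \<and> b \<ge> 2"

definition imprimitive_nt_code ::
    "'a set \<Rightarrow> nat \<Rightarrow> 'a set set \<Rightarrow> nat \<Rightarrow> nat \<Rightarrow> 'a set set \<Rightarrow> bool" where
  "imprimitive_nt_code \<Omega> k C a b \<B> \<longleftrightarrow>
    k \<ge> 2 \<and> finite \<Omega> \<and> card \<Omega> = 2 * k + 1 \<and> a * b = 2 * k + 1 \<and>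
    C \<subseteq> kneser_verts \<Omega> k \<and> card C \<ge> 2 \<and> neighbour_transitive \<Omega> k C \<and>
    transitive_on (\<lambda>g x. g x) (code_aut \<Omega> C) \<Omega> \<and>
    imprimitivity_system (code_aut \<Omega> C) \<Omega> a b \<B>"

definition iota :: "'a set set \<Rightarrow> 'a set \<Rightarrow> nat multiset" where
  "iota \<B> \<alpha> = image_mset (\<lambda>B. card (\<alpha> \<inter> B)) (mset_set \<B>)"

definition full_or_const_type :: "'a set \<Rightarrow> nat \<Rightarrow> 'a set set \<Rightarrow> nat \<Rightarrow> 'a set set \<Rightarrow> bool" where
  "full_or_const_type \<Omega> k C b \<B> \<longleftrightarrow>
    min_distance \<Omega> k C \<ge> 2 \<and>
    (\<exists>a\<^sub>0 a\<^sub>1 b\<^sub>1. \<forall>\<alpha>\<in>C. iota \<B> \<alpha> = replicate_mset a\<^sub>0 b + replicate_mset a\<^sub>1 b\<^sub>1)"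

text \<open>In the next two definitions the divisions are exact where they are used:
  \<open>a\<close> and \<open>b\<close> are odd because \<open>a * b = 2 * k + 1\<close>.\<close>

definition balanced_type ::
    "'a set \<Rightarrow> nat \<Rightarrow> 'a set set \<Rightarrow> nat \<Rightarrow> nat \<Rightarrow> 'a set set \<Rightarrow> bool" where
  "balanced_type \<Omega> k C a b \<B> \<longleftrightarrow>
    min_distance \<Omega> k C = 1 \<and>
    (\<forall>\<alpha>\<in>C. iota \<B> \<alpha> =
      replicate_mset ((a + 1) div 2) ((b - 1) div 2) +
      replicate_mset ((a - 1) div 2) ((b + 1) div 2))"

definition empty_or_full_type ::
    "'a set \<Rightarrow> nat \<Rightarrow> 'a set set \<Rightarrow> nat \<Rightarrow> nat \<Rightarrow> 'a set set \<Rightarrow> bool" where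
  "empty_or_full_type \<Omega> k C a b \<B> \<longleftrightarrow>
    min_distance \<Omega> k C = 1 \<and>
    (\<forall>\<alpha>\<in>C. iota \<B> \<alpha> =
      replicate_mset ((a - 1) div 2) 0 + {#(b - 1) div 2#} + replicate_mset ((a - 1) div 2) b)"

end

theory Submission imports Defs begin

text \<open>The type \<open>\<iota>\<close> is constant on \<open>C\<close> and on the set of neighbours of \<open>C\<close>. Every neighbour of a codeword
  \<open>\<alpha>\<close> is the complement of \<open>\<alpha>\<close> with one point \<open>x\<close> removed, and its type determines the number \<open>t\<close> of
  points of \<open>\<alpha>\<close> in the block of \<open>x\<close>. If \<open>\<delta> \<ge> 2\<close>, no neighbour of \<open>\<alpha>\<close> is a codeword, so all blocks not
  contained in \<open>\<alpha>\<close> share the same \<open>t\<close>. If \<open>\<delta> = 1\<close>, some neighbour has the same type as \<open>\<alpha>\<close>; counting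
  multiplicities gives \<open>t = (b - 1) / 2\<close> for it and shows that the type is symmetric under
  \<open>s \<mapsto> b - s\<close> up to one extra \<open>(b - 1) / 2\<close>. As only one further value below \<open>b\<close> may occur, the two
  remaining types follow.

  The infinite families consist of all sets of one fixed type \<open>I\<close> with respect to three blocks:
  \<open>I = {4c + 1, c, c}\<close> with \<open>b = 4c + 1\<close>, and \<open>I = {m, m, m + 1}\<close>, \<open>I = {0, m, 2m + 1}\<close> with
  \<open>b = 2m + 1\<close>.\<close>

section \<open>Distances and neighbours in odd graphs\<close>

text \<open>A nonempty set of extended naturals attains its infimum. A finite \<open>n\<close>
  excludes the empty set, whose infimum is infinite.\<close>

lemma enat_Inf_le_iff:
  fixes S :: "enat set"
  assumes "n < \<infinity>"
  shows "Inf S \<le> n \<longleftrightarrow> (\<exists>s\<in>S. s \<le> n)"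
proof
  assume *: "Inf S \<le> n"
  with assms have "S \<noteq> {}"
    by (auto simp: Inf_enat_def split: if_splits)
  then have "Inf S \<in> S"
    unfolding Inf_enat_def by (auto intro: LeastI)
  with * show "\<exists>s\<in>S. s \<le> n" by blast
qed (auto intro: Inf_lower2)

lemma graph_dist_eq_0_iff: "graph_dist E u v = 0 \<longleftrightarrow> u = v"
proof -
  have "graph_dist E u v \<le> 0 \<longleftrightarrow> u = v"
    unfolding graph_dist_def
    by (subst enat_Inf_le_iff) (auto simp: zero_enat_def)
  then show ?thesis by simp
qed

lemma graph_dist_le_1_iff: "graph_dist E u v \<le> 1 \<longleftrightarrow> u = v \<or> (u, v) \<in> E"
proof -
  have "graph_dist E u v \<le> 1 \<longleftrightarrow> (\<exists>n\<le>1. (u, v) \<in> E ^^ n)"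
    unfolding graph_dist_def
    by (subst enat_Inf_le_iff) (auto simp: one_enat_def)
  also have "\<dots> \<longleftrightarrow> u = v \<or> (u, v) \<in> E"
    by (auto simp: le_Suc_eq)
  finally show ?thesis .
qed

text \<open>Only the distances 0 and 1 have to be understood: distinct codewords are at distance at
  least 1, and distance 1 is disjointness. The condition that the two codewords differ matters for
  \<open>k = 0\<close>, where the empty set is disjoint from itself.\<close>

lemma min_distance_cases:
  defines "adj C \<equiv> (\<exists>\<alpha>\<in>C. \<exists>\<beta>\<in>C. \<alpha> \<noteq> \<beta> \<and> \<alpha> \<inter> \<beta> = {})"
  assumes "C \<subseteq> kneser_verts \<Omega> k"
  shows "min_distance \<Omega> k C = 1 \<longleftrightarrow> adj C" "min_distance \<Omega> k C \<ge> 2 \<longleftrightarrow> \<not> adj C"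
proof -
  have le1: "min_distance \<Omega> k C \<le> 1 \<longleftrightarrow> adj C"
    using assms unfolding min_distance_def
    by (subst enat_Inf_le_iff)
      (fastforce simp: adj_def graph_dist_le_1_iff kneser_edges_def)+
  have "\<not> min_distance \<Omega> k C \<le> 0"
    unfolding min_distance_def
    by (subst enat_Inf_le_iff) (auto simp: graph_dist_eq_0_iff)
  then have ge1: "min_distance \<Omega> k C \<ge> 1"
    by (simp add: ileI1 one_eSuc)
  show "min_distance \<Omega> k C = 1 \<longleftrightarrow> adj C"
    using le1 ge1 by auto
  have "2 \<le> d \<longleftrightarrow> \<not> d \<le> 1" for d :: enat
    by (cases d) (auto simp: one_enat_def numeral_eq_enat)
  with le1 show "min_distance \<Omega> k C \<ge> 2 \<longleftrightarrow> \<not> adj C"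
    by auto
qed

lemma code_neighbours_eq:
  assumes "C \<subseteq> kneser_verts \<Omega> k"
  shows "code_neighbours \<Omega> k C =
    {\<gamma> \<in> kneser_verts \<Omega> k. \<gamma> \<notin> C \<and> (\<exists>\<alpha>\<in>C. \<alpha> \<inter> \<gamma> = {})}"
proof -
  have "(INF \<alpha>\<in>C. graph_dist (kneser_edges \<Omega> k) \<alpha> \<gamma>) = 1 \<longleftrightarrow>
      \<gamma> \<notin> C \<and> (\<exists>\<alpha>\<in>C. \<alpha> \<inter> \<gamma> = {})" (is "?d = 1 \<longleftrightarrow> _")
    if "\<gamma> \<in> kneser_verts \<Omega> k" for \<gamma>
  proof -
    have "?d \<le> 0 \<longleftrightarrow> \<gamma> \<in> C"
      by (subst enat_Inf_le_iff) (auto simp: graph_dist_eq_0_iff)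
    moreover have "?d \<le> 1 \<longleftrightarrow> \<gamma> \<in> C \<or> (\<exists>\<alpha>\<in>C. \<alpha> \<inter> \<gamma> = {})"
      using assms that
      by (subst enat_Inf_le_iff) (auto simp: graph_dist_le_1_iff kneser_edges_def)
    moreover have "d = 1 \<longleftrightarrow> d \<le> 1 \<and> \<not> d \<le> 0" for d :: enat
      by (cases d) (auto simp: one_enat_def zero_enat_def)
    ultimately show ?thesis by blast
  qed
  then show ?thesis
    by (auto simp: code_neighbours_def)
qed

text \<open>The complement of a k-set has k + 1 points, so a k-set inside it omits exactly one.
  Neighbours are thus indexed by the omitted point.\<close>

lemma odd_graph_neighbour:
  assumes "finite \<Omega>" "card \<Omega> = 2 * k + 1" "\<alpha> \<in> kneser_verts \<Omega> k"
  shows "\<gamma> \<in> kneser_verts \<Omega> k \<and> \<alpha> \<inter> \<gamma> = {} \<longleftrightarrow> (\<exists>x\<in>\<Omega> - \<alpha>. \<gamma> = \<Omega> - \<alpha> - {x})"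
proof
  have card: "card (\<Omega> - \<alpha>) = k + 1"
    using assms finite_subset[of \<alpha> \<Omega>] by (simp add: kneser_verts_def card_Diff_subset)
  show "\<exists>x\<in>\<Omega> - \<alpha>. \<gamma> = \<Omega> - \<alpha> - {x}" if *: "\<gamma> \<in> kneser_verts \<Omega> k \<and> \<alpha> \<inter> \<gamma> = {}"
  proof -
    have "\<gamma> \<subseteq> \<Omega> - \<alpha>" "card \<gamma> = k" "finite \<gamma>"
      using * assms by (auto simp: kneser_verts_def intro: finite_subset)
    with card have "card (\<Omega> - \<alpha> - \<gamma>) = 1"
      by (simp add: card_Diff_subset)
    then obtain x where "\<Omega> - \<alpha> - \<gamma> = {x}"
      by (auto simp: card_1_singleton_iff)
    with \<open>\<gamma> \<subseteq> \<Omega> - \<alpha>\<close> have "x \<in> \<Omega> - \<alpha>" "\<gamma> = \<Omega> - \<alpha> - {x}"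
      by auto
    then show ?thesis by blast
  qed
  show "\<gamma> \<in> kneser_verts \<Omega> k \<and> \<alpha> \<inter> \<gamma> = {}" if "\<exists>x\<in>\<Omega> - \<alpha>. \<gamma> = \<Omega> - \<alpha> - {x}"
    using that card by (auto simp: kneser_verts_def)
qed

section \<open>Types of neighbours\<close>

text \<open>If \<open>\<alpha>\<close> has type \<open>I\<close>, then \<open>neighbour_type b I t\<close> is the type of \<open>\<Omega> - \<alpha> - {x}\<close>, where \<open>x\<close> lies
  outside \<open>\<alpha>\<close> in a block that \<open>\<alpha>\<close> meets in \<open>t\<close> points.\<close>

definition neighbour_type :: "nat \<Rightarrow> nat multiset \<Rightarrow> nat \<Rightarrow> nat multiset" where
  "neighbour_type b I t = add_mset (b - t - 1) (image_mset ((-) b) (I - {#t#}))"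

text \<open>For distinct s and t, cancelling the common entries leaves {b - s - 1, b - t} and {b - t
  - 1, b - s}. Since s < b, the entry b - s - 1 differs from b - s, so it must equal b - t -
  1.\<close>

lemma neighbour_type_inject:
  assumes "s \<in># I" "t \<in># I" "s < b" "t < b" "neighbour_type b I s = neighbour_type b I t"
  shows "s = t"
proof (rule ccontr)
  assume "s \<noteq> t"
  obtain I' where I': "I = add_mset s I'"
    using assms(1) by (metis insert_DiffM)
  with \<open>s \<noteq> t\<close> assms(2) obtain J where J: "I' = add_mset t J"
    by (metis insert_DiffM insert_noteq_member)
  have "add_mset (b - s - 1) {#b - t#} = add_mset (b - t - 1) {#b - s#}"
    using assms(5) \<open>s \<noteq> t\<close> unfolding I' J neighbour_type_def
    by (simp add: add_mset_commute)
  with assms(3,4) \<open>s \<noteq> t\<close> show False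
    by (auto simp: add_eq_conv_ex)
qed

text \<open>Complementation exchanges the multiplicities of u and b - u, and one entry b - t becomes
  b - t - 1. Writing the correction terms as summands on both sides avoids truncated
  subtraction.\<close>

lemma count_neighbour_type:
  assumes "\<forall>s\<in>#I. s \<le> b" "t \<in># I" "u \<le> b"
  shows "count (neighbour_type b I t) u + (if u = b - t then 1 else 0) =
    count I (b - u) + (if u = b - t - 1 then 1 else 0)"
proof -
  have *: "count (image_mset ((-) b) K) u = count K (b - u)" if "\<forall>s\<in>#K. s \<le> b" for K
    using that
  proof (induction K)
    case (add x K)
    then have "b - x = u \<longleftrightarrow> x = b - u"
      using assms(3) by auto
    with add show ?case by simp
  qed simp
  obtain I' where "I = add_mset t I'"
    using assms(2) by (metis insert_DiffM)
  then show ?thesis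
    using *[of I'] assms by (auto simp: neighbour_type_def)
qed

text \<open>Comparing the multiplicities of \<open>t\<close> and of \<open>b - t\<close> on both sides forces \<open>t = b - t - 1\<close>.\<close>

lemma neighbour_type_eq_self:
  assumes "odd b" "\<forall>s\<in>#I. s \<le> b" "t \<in># I" "t < b" "neighbour_type b I t = I"
  shows "b = 2 * t + 1"
proof -
  have "count I (b - t) + 1 = count I t"
    using count_neighbour_type[OF assms(2,3), of "b - t"] assms(4,5) by simp
  moreover have "count I t + (if t = b - t then 1 else 0) =
      count I (b - t) + (if t = b - t - 1 then 1 else 0)"
    using count_neighbour_type[OF assms(2,3), of t] assms(4,5) by simp
  moreover have "t \<noteq> b - t"
  proof
    assume "t = b - t"
    with assms(4) have "b = 2 * t" by linarith
    with assms(1) show False by simp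
  qed
  ultimately have "\<not> t \<noteq> b - t - 1"
    by (intro notI) (simp only: if_False)
  with assms(4) show ?thesis by linarith
qed

text \<open>The three values may coincide; the nested conditions then credit each entry to the first
  value that it equals.\<close>

lemma mset_three_values:
  assumes "set_mset I \<subseteq> {x, y, z}"
  obtains p q r where "I = replicate_mset p x + replicate_mset q y + replicate_mset r z"
proof -
  have "\<exists>p q r. I = replicate_mset p x + replicate_mset q y + replicate_mset r z"
    using assms
  proof (induction I)
    case empty
    show ?case by (intro exI[of _ 0]) simp
  next
    case (add w I)
    then obtain p q r where I: "I = replicate_mset p x + replicate_mset q y + replicate_mset r z"
      by auto
    have "add_mset w I =
      replicate_mset (if w = x then Suc p else p) x +
      replicate_mset (if w \<noteq> x \<and> w = y then Suc q else q) y +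
      replicate_mset (if w \<noteq> x \<and> w \<noteq> y then Suc r else r) z"
      using add.prems by (auto simp: I)
    then show ?case by blast
  qed
  with that show ?thesis by blast
qed

lemma mset_two_values:
  assumes "set_mset I \<subseteq> {x, y}"
  obtains p q where "I = replicate_mset p x + replicate_mset q y"
proof -
  obtain p q r where "I = replicate_mset p x + replicate_mset q y + replicate_mset r y"
    using assms by (auto intro: mset_three_values[of I x y y])
  then have "I = replicate_mset p x + replicate_mset (q + r) y"
    by (simp add: multiset_eq_iff)
  then show ?thesis by (rule that)
qed

text \<open>With b = 2m + 1, multiplicities are symmetric under u \<mapsto> b - u, except that m
  occurs once more than m + 1. By \<open>uniq\<close> at most one value other than m lies below b.
  If m + 1 occurs, it is that value, which excludes 0 and, by symmetry, b. Otherwise a value t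
  strictly between 0 and b, other than m, would bring b - t along, forcing t = b - t against the
  parity of b.\<close>

lemma self_neighbour_classification:
  assumes le: "\<forall>s\<in>#I. s \<le> b" and "odd b" "b \<ge> 2" "size I = a"
    and m: "m \<in># I" "m < b" "neighbour_type b I m = I"
    and uniq: "\<And>s t. \<lbrakk>s \<in># I; t \<in># I; s < b; t < b; s \<noteq> m; t \<noteq> m\<rbrakk> \<Longrightarrow> s = t"
  shows "I = replicate_mset ((a + 1) div 2) ((b - 1) div 2) +
      replicate_mset ((a - 1) div 2) ((b + 1) div 2) \<or>
    I = replicate_mset ((a - 1) div 2) 0 + {#(b - 1) div 2#} + replicate_mset ((a - 1) div 2) b"
proof -
  have b: "b = 2 * m + 1"
    by (rule neighbour_type_eq_self[OF assms(2,1) m])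
  with assms(3) have "m > 0" by simp
  have cnt: "count I u + (if u = m + 1 then 1 else 0) = count I (b - u) + (if u = m then 1 else 0)"
    if "u \<le> b" for u
    using count_neighbour_type[OF le m(1) that] m b by simp
  have sym: "b - u \<in># I" if "u \<in># I" "u \<noteq> m" for u
  proof -
    from that le have "u \<le> b" by blast
    with cnt[OF this] that show ?thesis
      by (simp add: count_greater_zero_iff[symmetric] split: if_splits del: count_greater_zero_iff)
  qed
  show ?thesis
  proof (cases "m + 1 \<in># I")
    case True
    \<comment> \<open>Otherwise 0 and m + 1 would be two distinct values below b, both different
      from m.\<close>
    have "0 \<notin># I"
      using uniq[of 0 "m + 1"] True \<open>m > 0\<close> b by auto
    then have "b \<notin># I"
      using sym[of b] b by auto
    have "set_mset I \<subseteq> {m, m + 1}"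
    proof
      fix t assume "t \<in># I"
      with \<open>b \<notin># I\<close> le have "t < b" by (metis order_le_less)
      with uniq[of t "m + 1"] True \<open>t \<in># I\<close> b \<open>m > 0\<close> show "t \<in> {m, m + 1}" by auto
    qed
    then obtain p q where I: "I = replicate_mset p m + replicate_mset q (m + 1)"
      by (rule mset_two_values)
    have "p = q + 1"
      using cnt[of m] b by (simp add: I)
    with \<open>size I = a\<close> have "a = 2 * q + 1"
      by (simp add: I)
    with \<open>p = q + 1\<close> I b show ?thesis by simp
  next
    case False
    have "set_mset I \<subseteq> {0, m, b}"
    proof
      fix t assume t: "t \<in># I"
      show "t \<in> {0, m, b}"
      proof (rule ccontr)
        assume n: "t \<notin> {0, m, b}"
        with t le have "t < b" by (auto simp: order_le_less)
        have "t \<noteq> m + 1"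
          using False t by auto
        then have "b - t \<noteq> m"
          using b \<open>t < b\<close> by linarith
        then have "t = b - t"
          using t n \<open>t < b\<close> by (intro uniq sym) simp_all
        then show False using b by presburger
      qed
    qed
    then obtain p q r where I: "I = replicate_mset p 0 + replicate_mset q m + replicate_mset r b"
      by (rule mset_three_values)
    have "p = r"
      using cnt[of 0] b \<open>m > 0\<close> by (simp add: I split: if_splits)
    \<comment> \<open>As m + 1 does not occur, the excess of m over m + 1 is its whole
      multiplicity.\<close>
    have "q = 1"
      using cnt[of m] b \<open>m > 0\<close> by (simp add: I)
    with \<open>size I = a\<close> \<open>p = r\<close> have "a = 2 * r + 1"
      by (simp add: I)
    with \<open>p = r\<close> \<open>q = 1\<close> I b show ?thesis by simp
  qed
qed

section \<open>Partitions into blocks of equal size\<close>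

locale block_partition =
  fixes \<Omega> :: "'a set" and \<B> :: "'a set set" and b :: nat
  assumes finite: "finite \<Omega>"
    and partition: "partition_on \<Omega> \<B>"
    and card_block: "\<And>B. B \<in> \<B> \<Longrightarrow> card B = b"
begin

lemma finite_blocks: "finite \<B>"
  using finite_elements[OF finite partition] .

lemma block_subset: "B \<in> \<B> \<Longrightarrow> B \<subseteq> \<Omega>"
  using partition by (auto simp: partition_on_def)

lemma finite_block: "B \<in> \<B> \<Longrightarrow> finite B"
  using block_subset finite finite_subset by blast

lemma obtain_block:
  assumes "x \<in> \<Omega>"
  obtains B where "B \<in> \<B>" "x \<in> B"
  using assms partition by (auto simp: partition_on_def)

lemma block_unique: "\<lbrakk>x \<in> B; x \<in> B'; B \<in> \<B>; B' \<in> \<B>\<rbrakk> \<Longrightarrow> B = B'"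
  using partition by (auto simp: partition_on_def disjoint_def)

lemma card_Int_le: "B \<in> \<B> \<Longrightarrow> card (\<alpha> \<inter> B) \<le> b"
  using card_mono[OF finite_block, of B "\<alpha> \<inter> B"] card_block by auto

lemma size_iota: "size (iota \<B> \<alpha>) = card \<B>"
  by (simp add: iota_def)

lemma iota_memI: "B \<in> \<B> \<Longrightarrow> card (\<alpha> \<inter> B) \<in># iota \<B> \<alpha>"
  using finite_blocks by (auto simp: iota_def)

lemma iota_memE:
  assumes "t \<in># iota \<B> \<alpha>"
  obtains B where "B \<in> \<B>" "t = card (\<alpha> \<inter> B)"
  using assms finite_blocks by (auto simp: iota_def)

lemma iota_le: "\<forall>t\<in>#iota \<B> \<alpha>. t \<le> b"
  by (auto elim!: iota_memE simp: card_Int_le)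

lemma sum_mset_iota:
  assumes "\<alpha> \<subseteq> \<Omega>"
  shows "sum_mset (iota \<B> \<alpha>) = card \<alpha>"
proof -
  have "\<alpha> = (\<Union>B\<in>\<B>. \<alpha> \<inter> B)"
    using assms partition by (auto simp: partition_on_def)
  moreover have "card (\<Union>B\<in>\<B>. \<alpha> \<inter> B) = (\<Sum>B\<in>\<B>. card (\<alpha> \<inter> B))"
    using finite_blocks finite_block block_unique by (intro card_UN_disjoint) auto
  ultimately show ?thesis
    by (simp add: iota_def sum_unfold_sum_mset)
qed

lemma iota_neighbour:
  assumes "B \<in> \<B>" "x \<in> B" "x \<notin> \<alpha>"
  shows "iota \<B> (\<Omega> - \<alpha> - {x}) = neighbour_type b (iota \<B> \<alpha>) (card (\<alpha> \<inter> B))"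
proof -
  have compl: "card ((\<Omega> - \<alpha>) \<inter> B') = b - card (\<alpha> \<inter> B')" if "B' \<in> \<B>" for B'
  proof -
    have "(\<Omega> - \<alpha>) \<inter> B' = B' - \<alpha> \<inter> B'"
      using block_subset[OF that] by auto
    then show ?thesis
      using finite_block[OF that] card_block[OF that] by (simp add: card_Diff_subset)
  qed
  have 1: "card ((\<Omega> - \<alpha> - {x}) \<inter> B) = b - card (\<alpha> \<inter> B) - 1"
  proof -
    have "(\<Omega> - \<alpha> - {x}) \<inter> B = (\<Omega> - \<alpha>) \<inter> B - {x}" "x \<in> (\<Omega> - \<alpha>) \<inter> B"
      using assms block_subset by auto
    then show ?thesis
      using compl[OF assms(1)] by simp
  qed
  have 2: "card ((\<Omega> - \<alpha> - {x}) \<inter> B') = b - card (\<alpha> \<inter> B')" if "B' \<in> \<B> - {B}" for B'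
  proof -
    have "x \<notin> B'"
      using that assms block_unique by blast
    then have "(\<Omega> - \<alpha> - {x}) \<inter> B' = (\<Omega> - \<alpha>) \<inter> B'"
      by auto
    then show ?thesis
      using compl that by simp
  qed
  have split: "mset_set \<B> = add_mset B (mset_set (\<B> - {B}))"
    using finite_blocks assms(1) by (simp add: mset_set.remove)
  have "image_mset (\<lambda>B'. card ((\<Omega> - \<alpha> - {x}) \<inter> B')) (mset_set (\<B> - {B})) =
      image_mset (\<lambda>B'. b - card (\<alpha> \<inter> B')) (mset_set (\<B> - {B}))"
    using 2 by (intro image_mset_cong) (use finite_blocks in auto)
  with 1 show ?thesis
    by (simp add: iota_def split neighbour_type_def image_mset.compositionality o_def)
qed

text \<open>An injective map of the finite set of blocks into itself permutes the blocks, so the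
  multiset is only reindexed.\<close>

lemma iota_image:
  assumes "g permutes \<Omega>" "\<forall>B\<in>\<B>. g ` B \<in> \<B>"
  shows "iota \<B> (g ` \<alpha>) = iota \<B> \<alpha>"
proof -
  have inj: "inj g"
    using assms(1) by (rule permutes_inj)
  then have inj': "inj_on ((`) g) \<B>"
    by (meson inj_image_eq_iff inj_onI)
  then have "(`) g ` \<B> = \<B>"
    using assms(2) finite_blocks by (intro endo_inj_surj) auto
  then have "mset_set \<B> = image_mset ((`) g) (mset_set \<B>)"
    using image_mset_mset_set[OF inj'] by simp
  then have "iota \<B> (g ` \<alpha>) = image_mset (\<lambda>B. card (g ` \<alpha> \<inter> B)) (image_mset ((`) g) (mset_set \<B>))"
    unfolding iota_def by simp
  also have "\<dots> = iota \<B> \<alpha>"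
    unfolding iota_def image_mset.compositionality o_def
    using inj by (simp add: image_Int[symmetric] card_image inj_on_subset)
  finally show ?thesis .
qed

text \<open>An entry below b belongs to a block with a point outside \<alpha>; omitting that point
  from the complement gives the neighbour. Together with the converse
  \<open>neighbour_typeE\<close>, this reduces questions on neighbours to arithmetic on
  types.\<close>

lemma ex_neighbour_of_type:
  assumes "card \<Omega> = 2 * k + 1" "\<alpha> \<in> kneser_verts \<Omega> k" "t \<in># iota \<B> \<alpha>" "t < b"
  shows "\<exists>\<gamma>\<in>kneser_verts \<Omega> k. \<alpha> \<inter> \<gamma> = {} \<and> iota \<B> \<gamma> = neighbour_type b (iota \<B> \<alpha>) t"
proof -
  obtain B where B: "B \<in> \<B>" "t = card (\<alpha> \<inter> B)"
    using assms(3) by (rule iota_memE)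
  then have "\<alpha> \<inter> B \<noteq> B"
    using card_block assms(4) by auto
  then obtain x where x: "x \<in> B" "x \<notin> \<alpha>" by blast
  then have "x \<in> \<Omega> - \<alpha>"
    using block_subset B(1) by blast
  then have "\<Omega> - \<alpha> - {x} \<in> kneser_verts \<Omega> k \<and> \<alpha> \<inter> (\<Omega> - \<alpha> - {x}) = {}"
    using odd_graph_neighbour[OF finite assms(1,2)] by blast
  then show ?thesis
    using iota_neighbour[OF B(1) x] B(2) by blast
qed

lemma neighbour_typeE:
  assumes "card \<Omega> = 2 * k + 1" "\<alpha> \<in> kneser_verts \<Omega> k" "\<gamma> \<in> kneser_verts \<Omega> k" "\<alpha> \<inter> \<gamma> = {}"
  obtains t where "t \<in># iota \<B> \<alpha>" "t < b" "iota \<B> \<gamma> = neighbour_type b (iota \<B> \<alpha>) t"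
proof -
  obtain x where x: "x \<in> \<Omega> - \<alpha>" "\<gamma> = \<Omega> - \<alpha> - {x}"
    using odd_graph_neighbour[OF finite assms(1,2), of \<gamma>] assms(3,4) by blast
  then obtain B where B: "B \<in> \<B>" "x \<in> B"
    by (blast elim: obtain_block)
  then have "\<alpha> \<inter> B \<subset> B"
    using x by auto
  then have "card (\<alpha> \<inter> B) < b"
    using psubset_card_mono[OF finite_block[OF B(1)]] card_block[OF B(1)] by simp
  then show ?thesis
    using that[OF iota_memI[OF B(1)]] iota_neighbour[OF B, of \<alpha>] x by simp
qed

end

section \<open>Classification of the types of codewords\<close>

lemma imprimitive_nt_code_classification:
  assumes "imprimitive_nt_code \<Omega> k C a b \<B>"
  shows "full_or_const_type \<Omega> k C b \<B> \<or> balanced_type \<Omega> k C a b \<B> \<or>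
    empty_or_full_type \<Omega> k C a b \<B>"
proof -
  let ?G = "code_aut \<Omega> C" and ?N = "code_neighbours \<Omega> k C"
  note defs = imprimitive_nt_code_def imprimitivity_system_def neighbour_transitive_def
  interpret block_partition \<Omega> \<B> b
    using assms by unfold_locales (auto simp: defs)
  have C: "C \<subseteq> kneser_verts \<Omega> k" and card_\<Omega>: "card \<Omega> = 2 * k + 1" and ab: "a * b = 2 * k + 1"
    and "b \<ge> 2" "card \<B> = a"
    using assms by (auto simp: defs)
  have "odd b"
    using arg_cong[OF ab, of odd] by simp
  have orbit: "iota \<B> \<alpha> = iota \<B> \<beta>" if X: "transitive_on (`) ?G X" "\<alpha> \<in> X" "\<beta> \<in> X" for X \<alpha> \<beta>
  proof -
    obtain g where "g \<in> ?G" "g ` \<alpha> = \<beta>"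
      using X unfolding transitive_on_def by blast
    moreover from this have "g permutes \<Omega>" "\<forall>B\<in>\<B>. g ` B \<in> \<B>"
      using assms by (auto simp: defs code_aut_def)
    ultimately show ?thesis
      using iota_image[of g \<alpha>] by simp
  qed
  have "C \<noteq> {}"
    using assms by (auto simp: defs)
  then obtain \<alpha>\<^sub>0 where \<alpha>\<^sub>0: "\<alpha>\<^sub>0 \<in> C" by blast
  define I where "I = iota \<B> \<alpha>\<^sub>0"
  have iota_C: "iota \<B> \<alpha> = I" if "\<alpha> \<in> C" for \<alpha>
    using orbit[OF _ that \<alpha>\<^sub>0] assms by (auto simp: I_def defs)
  have I_le: "\<forall>t\<in>#I. t \<le> b" and size_I: "size I = a"
    using iota_le size_iota \<open>card \<B> = a\<close> by (auto simp: I_def)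
  have neighbour: "\<exists>\<gamma>\<in>kneser_verts \<Omega> k. \<alpha>\<^sub>0 \<inter> \<gamma> = {} \<and> iota \<B> \<gamma> = neighbour_type b I t"
    if "t \<in># I" "t < b" for t
    using ex_neighbour_of_type[OF card_\<Omega>] \<alpha>\<^sub>0 C that by (auto simp: I_def)
  \<comment> \<open>If no neighbour of these two types is a codeword, both types occur on
    \<open>?N\<close>, where the type is constant; injectivity of \<open>neighbour_type\<close> then
    identifies s and t. The two cases below discharge \<open>out\<close> in different ways.\<close>
  have inject: "s = t"
    if st: "s \<in># I" "t \<in># I" "s < b" "t < b" and
      out: "\<And>\<gamma>. \<lbrakk>\<gamma> \<in> kneser_verts \<Omega> k; \<alpha>\<^sub>0 \<inter> \<gamma> = {};
        iota \<B> \<gamma> \<in> {neighbour_type b I s, neighbour_type b I t}\<rbrakk> \<Longrightarrow> \<gamma> \<notin> C" for s t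
  proof -
    obtain \<gamma> where \<gamma>: "\<gamma> \<in> kneser_verts \<Omega> k" "\<alpha>\<^sub>0 \<inter> \<gamma> = {}" "iota \<B> \<gamma> = neighbour_type b I s"
      using neighbour[OF st(1,3)] by blast
    obtain \<gamma>' where \<gamma>': "\<gamma>' \<in> kneser_verts \<Omega> k" "\<alpha>\<^sub>0 \<inter> \<gamma>' = {}" "iota \<B> \<gamma>' = neighbour_type b I t"
      using neighbour[OF st(2,4)] by blast
    have "\<gamma> \<in> ?N" "\<gamma>' \<in> ?N"
      unfolding code_neighbours_eq[OF C] using \<alpha>\<^sub>0 out \<gamma> \<gamma>' by blast+
    moreover have "transitive_on (`) ?G ?N"
      using assms by (auto simp: defs)
    ultimately have "iota \<B> \<gamma> = iota \<B> \<gamma>'"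
      using orbit by blast
    with \<gamma> \<gamma>' show ?thesis
      using neighbour_type_inject[OF st(1-4)] by simp
  qed
  show ?thesis
  proof (cases "\<exists>\<alpha>\<in>C. \<exists>\<beta>\<in>C. \<alpha> \<noteq> \<beta> \<and> \<alpha> \<inter> \<beta> = {}")
    case True
    then obtain \<alpha> \<beta> where "\<alpha> \<in> C" "\<beta> \<in> C" "\<alpha> \<inter> \<beta> = {}" by blast
    \<comment> \<open>Two adjacent codewords both have type \<open>I\<close>, so \<open>I\<close> is
      a neighbour type of itself.\<close>
    then obtain m where m: "m \<in># I" "m < b" "neighbour_type b I m = I"
      using neighbour_typeE[OF card_\<Omega>, of \<alpha> \<beta>] C iota_C by (metis subsetD)
    have uniq: "s = t"
      if "s \<in># I" "t \<in># I" "s < b" "t < b" "s \<noteq> m" "t \<noteq> m" for s t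
    proof (rule inject[OF that(1-4)])
      have "neighbour_type b I u \<noteq> I" if "u \<in># I" "u < b" "u \<noteq> m" for u
        using neighbour_type_inject[OF that(1) m(1) that(2) m(2)] that(3) m(3) by auto
      then show "\<gamma> \<notin> C" if "iota \<B> \<gamma> \<in> {neighbour_type b I s, neighbour_type b I t}" for \<gamma>
        using iota_C[of \<gamma>] that \<open>s \<in># I\<close> \<open>t \<in># I\<close> \<open>s < b\<close> \<open>t < b\<close>
          \<open>s \<noteq> m\<close> \<open>t \<noteq> m\<close> by auto
    qed
    have "min_distance \<Omega> k C = 1"
      using True min_distance_cases(1)[OF C] by simp
    moreover note self_neighbour_classification[OF I_le \<open>odd b\<close> \<open>b \<ge> 2\<close> size_I m uniq]
    ultimately show ?thesis
      unfolding balanced_type_def empty_or_full_type_def using iota_C by auto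
  next
    case False
    have "s = t" if "s \<in># I" "t \<in># I" "s < b" "t < b" for s t
    proof (rule inject[OF that])
      \<comment> \<open>A set disjoint from a nonempty codeword differs from it, so it cannot be a
        codeword when no two distinct codewords are disjoint.\<close>
      have "\<alpha>\<^sub>0 \<noteq> {}"
        using \<alpha>\<^sub>0 C assms by (auto simp: kneser_verts_def defs)
      then show "\<gamma> \<notin> C" if "\<alpha>\<^sub>0 \<inter> \<gamma> = {}" for \<gamma>
        using False \<alpha>\<^sub>0 that by auto
    qed
    with I_le have "\<exists>c. set_mset I \<subseteq> {b, c}"
      by (metis insert_iff order_le_less subsetI)
    then obtain c a\<^sub>0 a\<^sub>1 where "I = replicate_mset a\<^sub>0 b + replicate_mset a\<^sub>1 c"
      by (metis mset_two_values)
    moreover have "min_distance \<Omega> k C \<ge> 2"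
      using False min_distance_cases(2)[OF C] by simp
    ultimately show ?thesis
      unfolding full_or_const_type_def using iota_C by blast
  qed
qed

section \<open>The code of all sets of a given type\<close>

lemma ex_image_mset_eq:
  assumes "finite A" "size M = card A"
  shows "\<exists>f. image_mset f (mset_set A) = M"
  using assms
proof (induction A arbitrary: M)
  case (insert x A)
  then obtain y M' where M: "M = add_mset y M'"
    by (metis card_insert_disjoint size_eq_Suc_imp_eq_union)
  with insert obtain f where "image_mset f (mset_set A) = M'"
    by fastforce
  then have "image_mset (f(x := y)) (mset_set (insert x A)) = M"
    using insert.hyps M by (auto intro!: image_mset_cong)
  then show ?case by blast
qed simp

lemma ex_bij_betw_mapping_subset:
  assumes "finite A" "finite B" "card A = card B" "S \<subseteq> A" "T \<subseteq> B" "card S = card T"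
  shows "\<exists>h. bij_betw h A B \<and> h ` S = T"
proof -
  have fin: "finite S" "finite T"
    using assms finite_subset by blast+
  obtain f where f: "bij_betw f S T"
    using finite_same_card_bij[OF fin assms(6)] by blast
  have "card (A - S) = card (B - T)"
    using assms fin by (simp add: card_Diff_subset)
  then obtain g where g: "bij_betw g (A - S) (B - T)"
    using finite_same_card_bij[of "A - S" "B - T"] assms by auto
  let ?h = "\<lambda>x. if x \<in> S then f x else g x"
  have "bij_betw ?h (S \<union> (A - S)) (T \<union> (B - T))"
    using f g by (intro bij_betw_disjoint_Un) auto
  moreover have "S \<union> (A - S) = A" "T \<union> (B - T) = B"
    using assms by auto
  moreover have "?h ` S = T"
    using f by (auto simp: bij_betw_def)
  ultimately show ?thesis by auto
qed

context block_partition
begin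

text \<open>Converse of \<open>iota_image\<close>: sets of equal type lie in one orbit of the full
  stabiliser of the partition. Equality of multisets yields a permutation p of the blocks that
  matches intersection sizes, and bijections from each B onto p B that carry \<alpha> to \<beta> are
  glued together.\<close>

lemma ex_block_perm_mapping:
  assumes "\<alpha> \<subseteq> \<Omega>" "\<beta> \<subseteq> \<Omega>" "iota \<B> \<alpha> = iota \<B> \<beta>"
  shows "\<exists>g. g permutes \<Omega> \<and> (\<forall>B\<in>\<B>. g ` B \<in> \<B>) \<and> g ` \<alpha> = \<beta>"
proof -
  obtain p where p: "p permutes \<B>" "\<forall>B\<in>\<B>. card (\<alpha> \<inter> B) = card (\<beta> \<inter> p B)"
    using image_mset_eq_implies_permutes[OF finite_blocks assms(3)[unfolded iota_def]] by blast
  have pB: "p B \<in> \<B>" if "B \<in> \<B>" for B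
    using p(1) that by (simp add: permutes_in_image)
  have "\<exists>h. bij_betw h B (p B) \<and> h ` (\<alpha> \<inter> B) = \<beta> \<inter> p B" if "B \<in> \<B>" for B
    using p(2) that pB finite_block card_block by (intro ex_bij_betw_mapping_subset) auto
  then obtain h where h: "bij_betw (h B) B (p B)" "h B ` (\<alpha> \<inter> B) = \<beta> \<inter> p B" if "B \<in> \<B>" for B
    by metis
  \<comment> \<open>The choice is of the unique block containing x; fixing all points outside
    \<Omega> is required by \<open>permutes\<close>.\<close>
  define g where "g x = (if x \<in> \<Omega> then h (SOME B. B \<in> \<B> \<and> x \<in> B) x else x)" for x
  have g: "g x = h B x" if "B \<in> \<B>" "x \<in> B" for x B
  proof -
    have "(SOME B. B \<in> \<B> \<and> x \<in> B) = B"
      using that block_unique by (intro some_equality) auto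
    then show ?thesis
      using that block_subset by (auto simp: g_def)
  qed
  have g_image: "g ` S = h B ` S" if "B \<in> \<B>" "S \<subseteq> B" for S B
    using that g by (intro image_cong) auto
  have g_block: "g ` B = p B" if "B \<in> \<B>" for B
    using g_image[OF that order_refl] h(1)[OF that] by (simp add: bij_betw_def)
  have "inj_on g \<Omega>"
  proof (rule inj_onI)
    fix x y assume xy: "x \<in> \<Omega>" "y \<in> \<Omega>" "g x = g y"
    obtain B where B: "B \<in> \<B>" "x \<in> B" using xy(1) by (rule obtain_block)
    obtain B' where B': "B' \<in> \<B>" "y \<in> B'" using xy(2) by (rule obtain_block)
    have "g x \<in> p B" "g y \<in> p B'"
      using g_block B B' by blast+
    then have "p B = p B'"
      using xy(3) pB B(1) B'(1) block_unique by metis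
    then have "B = B'"
      using permutes_inj[OF p(1)] by (simp add: inj_eq)
    then show "x = y"
      using h(1)[OF B(1)] xy(3) B B' g by (auto simp: bij_betw_def inj_on_def)
  qed
  moreover have "g ` \<Omega> \<subseteq> \<Omega>"
  proof
    fix y assume "y \<in> g ` \<Omega>"
    then obtain x where x: "x \<in> \<Omega>" "y = g x" by blast
    then obtain B where "B \<in> \<B>" "x \<in> B" by (blast elim: obtain_block)
    then have "y \<in> p B" "p B \<subseteq> \<Omega>"
      using g_block x pB block_subset by blast+
    then show "y \<in> \<Omega>" by blast
  qed
  ultimately have "bij_betw g \<Omega> \<Omega>"
    using finite by (simp add: bij_betw_def endo_inj_surj)
  then have "g permutes \<Omega>"
    by (rule bij_imp_permutes) (simp add: g_def)
  moreover have "g ` \<alpha> = \<beta>"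
  proof -
    have cover: "S = (\<Union>B\<in>\<B>. S \<inter> B)" if "S \<subseteq> \<Omega>" for S
      using that partition by (auto simp: partition_on_def)
    have "g ` \<alpha> = (\<Union>B\<in>\<B>. g ` (\<alpha> \<inter> B))"
      using arg_cong[OF cover[OF assms(1)], of "(`) g"] by (simp only: image_UN)
    also have "\<dots> = (\<Union>B\<in>\<B>. \<beta> \<inter> p B)"
      using g_image h(2) by (intro SUP_cong) auto
    also have "\<dots> = (\<Union>B\<in>p ` \<B>. \<beta> \<inter> B)"
      by auto
    also have "\<dots> = \<beta>"
      using cover[OF assms(2)] permutes_image[OF p(1)] by simp
    finally show ?thesis .
  qed
  ultimately show ?thesis
    using g_block pB by auto
qed

text \<open>All singletons share one type, so transitivity on points becomes an instance of
  transitivity on sets of equal type.\<close>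

lemma iota_singleton_eq:
  assumes "x \<in> \<Omega>"
  shows "iota \<B> {x} = add_mset 1 (replicate_mset (card \<B> - 1) 0)"
proof -
  obtain B where B: "B \<in> \<B>" "x \<in> B" using assms by (rule obtain_block)
  have "image_mset (\<lambda>B. card ({x} \<inter> B)) (mset_set (\<B> - {B})) = image_mset (\<lambda>_. 0) (mset_set (\<B> - {B}))"
    using B block_unique finite_blocks by (intro image_mset_cong) auto
  with B show ?thesis
    using finite_blocks by (simp add: iota_def mset_set.remove[of \<B> B] image_mset_const_eq)
qed

lemma iota_split:
  assumes "B \<in> \<B>" "B' \<in> \<B>" "B \<noteq> B'"
  shows "iota \<B> \<alpha> = add_mset (card (\<alpha> \<inter> B)) (add_mset (card (\<alpha> \<inter> B'))
    (image_mset (\<lambda>D. card (\<alpha> \<inter> D)) (mset_set (\<B> - {B} - {B'}))))"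
  using assms finite_blocks
  by (simp add: iota_def mset_set.remove[of \<B> B] mset_set.remove[of "\<B> - {B}" B'])

text \<open>The exchange replaces two entries p, q by p - 1, q + 1 and keeps the others. As p is
  positive, p - 1 differs from p, so an unchanged multiset forces p - 1 = q.\<close>

lemma iota_exchange:
  assumes B: "B \<in> \<B>" "B' \<in> \<B>" "B \<noteq> B'" and x: "x \<in> B" "x \<in> \<alpha>" and y: "y \<in> B'" "y \<notin> \<alpha>"
    and eq: "iota \<B> (insert y (\<alpha> - {x})) = iota \<B> \<alpha>"
  shows "card (\<alpha> \<inter> B) = card (\<alpha> \<inter> B') + 1"
proof -
  let ?\<alpha>' = "insert y (\<alpha> - {x})"
  have nin: "y \<notin> D" if "D \<in> \<B> - {B'}" for D
    using that y(1) B block_unique by blast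
  have nin': "x \<notin> D" if "D \<in> \<B> - {B}" for D
    using that x(1) B block_unique by blast
  have "?\<alpha>' \<inter> B = (\<alpha> \<inter> B) - {x}" "?\<alpha>' \<inter> B' = insert y (\<alpha> \<inter> B')"
    using nin[of B] nin'[of B'] B y by auto
  moreover have "finite (\<alpha> \<inter> B)" "finite (\<alpha> \<inter> B')"
    using finite_block B by auto
  ultimately have c: "card (?\<alpha>' \<inter> B) = card (\<alpha> \<inter> B) - 1" "card (?\<alpha>' \<inter> B') = card (\<alpha> \<inter> B') + 1"
    using x y by simp_all
  have pos: "card (\<alpha> \<inter> B) > 0"
    using \<open>finite (\<alpha> \<inter> B)\<close> x by (auto simp: card_gt_0_iff)
  have "image_mset (\<lambda>D. card (?\<alpha>' \<inter> D)) (mset_set (\<B> - {B} - {B'})) =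
      image_mset (\<lambda>D. card (\<alpha> \<inter> D)) (mset_set (\<B> - {B} - {B'}))"
  proof (rule image_mset_cong)
    fix D assume "D \<in># mset_set (\<B> - {B} - {B'})"
    then have "?\<alpha>' \<inter> D = \<alpha> \<inter> D"
      using nin[of D] nin'[of D] finite_blocks by auto
    then show "card (?\<alpha>' \<inter> D) = card (\<alpha> \<inter> D)" by simp
  qed
  then have "{#card (\<alpha> \<inter> B) - 1, card (\<alpha> \<inter> B') + 1#} = {#card (\<alpha> \<inter> B), card (\<alpha> \<inter> B')#}"
    using eq unfolding iota_split[OF B] c by (simp add: add_mset_commute)
  then show ?thesis
    using pos by (auto simp: add_eq_conv_ex)
qed

text \<open>u > 0 leaves room to include x in B, v < b leaves room to avoid y in B', and the other
  entries are distributed arbitrarily over the other blocks.\<close>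

lemma ex_set_of_type:
  assumes B: "B \<in> \<B>" "B' \<in> \<B>" "B \<noteq> B'" and xy: "x \<in> B" "y \<in> B'"
    and I: "size I = card \<B>" "{#u, v#} \<subseteq># I" "\<forall>t\<in>#I. t \<le> b" and uv: "0 < u" "v < b"
  shows "\<exists>\<alpha>. \<alpha> \<subseteq> \<Omega> \<and> iota \<B> \<alpha> = I \<and> x \<in> \<alpha> \<and> y \<notin> \<alpha> \<and> card (\<alpha> \<inter> B) = u \<and> card (\<alpha> \<inter> B') = v"
proof -
  obtain R where R: "I = add_mset u (add_mset v R)"
    using I(2) by (auto simp: mset_subset_eq_exists_conv)
  have "size R = card (\<B> - {B} - {B'})"
    using I(1) B finite_blocks R by (simp add: card_Diff_singleton)
  then obtain f where f: "image_mset f (mset_set (\<B> - {B} - {B'})) = R"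
    using ex_image_mset_eq[of "\<B> - {B} - {B'}" R] finite_blocks by auto
  define f' where "f' = f(B := u, B' := v)"
  have ffB: "f' B = u" "f' B' = v"
    using B by (auto simp: f'_def)
  have le: "f' D \<le> b" if "D \<in> \<B>" for D
  proof (cases "D = B \<or> D = B'")
    case True
    then show ?thesis using ffB I(3) R by auto
  next
    case False
    then have "f D \<in># R"
      using f that finite_blocks by auto
    then show ?thesis using False I(3) R by (auto simp: f'_def)
  qed
  have "\<exists>S\<subseteq>D. card S = f' D \<and> (x \<in> D \<longrightarrow> x \<in> S) \<and> (y \<in> D \<longrightarrow> y \<notin> S)" if D: "D \<in> \<B>" for D
  proof -
    consider "D = B" "y \<notin> D" | "D = B'" "x \<notin> D" | "x \<notin> D" "y \<notin> D"
      using D B xy block_unique by metis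
    then show ?thesis
    proof cases
      case 1
      have "u - 1 \<le> card (D - {x})"
        using le[OF D] 1 ffB card_block[OF D] finite_block[OF D] xy by (simp add: card_Diff_singleton)
      then obtain S where S: "S \<subseteq> D - {x}" "card S = u - 1" "finite S"
        by (rule obtain_subset_with_card_n)
      then have "card (insert x S) = u"
        using uv(1) by (subst card_insert_disjoint) auto
      then show ?thesis
        using S 1 xy ffB by (intro exI[of _ "insert x S"]) auto
    next
      case 2
      have "v \<le> card (D - {y})"
        using uv 2 card_block[OF D] finite_block[OF D] xy by (simp add: card_Diff_singleton)
      then obtain S where "S \<subseteq> D - {y}" "card S = v" "finite S"
        by (rule obtain_subset_with_card_n)
      then show ?thesis
        using 2 ffB by (intro exI[of _ S]) auto
    next
      case 3
      have "f' D \<le> card D"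
        using le[OF D] card_block[OF D] by simp
      then obtain S where "S \<subseteq> D" "card S = f' D" "finite S"
        by (rule obtain_subset_with_card_n)
      then show ?thesis
        using 3 by blast
    qed
  qed
  then obtain S where S: "S D \<subseteq> D" "card (S D) = f' D" "x \<in> D \<Longrightarrow> x \<in> S D" "y \<in> D \<Longrightarrow> y \<notin> S D"
    if "D \<in> \<B>" for D
    by metis
  define \<alpha> where "\<alpha> = (\<Union>D\<in>\<B>. S D)"
  have \<alpha>_Int: "\<alpha> \<inter> D = S D" if "D \<in> \<B>" for D
    using that S(1) block_unique unfolding \<alpha>_def by blast
  have "\<alpha> \<subseteq> \<Omega>"
    using S(1) block_subset unfolding \<alpha>_def by blast
  moreover have "x \<in> \<alpha>" "y \<notin> \<alpha>"
    using \<alpha>_Int[OF B(1)] \<alpha>_Int[OF B(2)] S(3)[OF B(1)] S(4)[OF B(2)] xy by auto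
  moreover have c: "card (\<alpha> \<inter> D) = f' D" if "D \<in> \<B>" for D
    using \<alpha>_Int S(2) that by simp
  moreover have "image_mset (\<lambda>D. card (\<alpha> \<inter> D)) (mset_set (\<B> - {B} - {B'})) = R"
    unfolding f[symmetric] using c finite_blocks by (intro image_mset_cong) (auto simp: f'_def)
  then have "iota \<B> \<alpha> = I"
    using iota_split[OF B] c B ffB R by simp
  ultimately show ?thesis
    using B ffB by blast
qed

text \<open>Two points lie in the same block iff swapping them preserves the code, a relation that every
  automorphism of the code respects.\<close>

lemma code_aut_preserves_blocks:
  assumes I: "size I = card \<B>" "{#u, v#} \<subseteq># I" "\<forall>t\<in>#I. t \<le> b" "0 < u" "v < b" "u \<noteq> v + 1"
    and g: "g \<in> code_aut \<Omega> {\<alpha>. \<alpha> \<subseteq> \<Omega> \<and> iota \<B> \<alpha> = I}" (is "g \<in> code_aut _ ?C")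
    and B: "B \<in> \<B>"
  shows "g ` B \<in> \<B>"
proof -
  have perm: "g permutes \<Omega>" and gC: "(`) g ` ?C = ?C"
    using g by (auto simp: code_aut_def)
  have inj: "inj g"
    using perm by (rule permutes_inj)
  have same: "D = D'"
    if xy: "x \<in> B" "y \<in> B" and D: "D \<in> \<B>" "g x \<in> D" "D' \<in> \<B>" "g y \<in> D'" for x y D D'
  proof (rule ccontr)
    assume "D \<noteq> D'"
    \<comment> \<open>Swapping x and y inside B preserves the code, hence so does swapping their
      images under g. Applied to this \<alpha>, the swap would give u = v + 1.\<close>
    obtain \<alpha> where \<alpha>: "\<alpha> \<in> ?C" "g x \<in> \<alpha>" "g y \<notin> \<alpha>" "card (\<alpha> \<inter> D) = u" "card (\<alpha> \<inter> D') = v"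
      using ex_set_of_type[OF D(1,3) \<open>D \<noteq> D'\<close> D(2,4) I(1-5)] by auto
    have "\<alpha> \<in> (`) g ` ?C"
      unfolding gC by (rule \<alpha>(1))
    then obtain \<beta> where \<beta>: "\<beta> \<in> ?C" "\<alpha> = g ` \<beta>"
      by (elim imageE)
    let ?\<tau> = "transpose x y"
    have perm_\<tau>: "?\<tau> permutes \<Omega>"
      using xy B block_subset by (intro permutes_swap_id) auto
    moreover have "?\<tau> ` E = E" if "E \<in> \<B>" for E
      using that xy B block_unique by (intro transpose_image_eq) blast
    ultimately have "iota \<B> (?\<tau> ` \<beta>) = I"
      using iota_image[of ?\<tau> \<beta>] \<beta>(1) by simp
    moreover have "?\<tau> ` \<beta> \<subseteq> \<Omega>"
      using image_mono[of \<beta> \<Omega> ?\<tau>] \<beta>(1) permutes_image[OF perm_\<tau>] by simp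
    ultimately have "g ` ?\<tau> ` \<beta> \<in> (`) g ` ?C"
      by (intro imageI CollectI conjI)
    then have "g ` ?\<tau> ` \<beta> \<in> ?C"
      unfolding gC .
    moreover have "g ` ?\<tau> ` \<beta> = insert (g y) (\<alpha> - {g x})"
    proof -
      have "x \<in> \<beta>" "y \<notin> \<beta>"
        using \<alpha> \<beta> inj by (auto simp: inj_image_mem_iff)
      then have "?\<tau> ` \<beta> = insert y (\<beta> - {x})"
        by (auto simp: transpose_def image_iff)
      then show ?thesis
        using inj \<beta>(2) by (simp add: image_set_diff)
    qed
    ultimately have "iota \<B> (insert (g y) (\<alpha> - {g x})) = iota \<B> \<alpha>"
      using \<alpha>(1) by simp
    from iota_exchange[OF D(1,3) \<open>D \<noteq> D'\<close> D(2) \<alpha>(2) D(4) \<alpha>(3) this] \<alpha> I(6) show False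
      by simp
  qed
  have "B \<noteq> {}"
    using B partition by (auto simp: partition_on_def)
  then obtain x where x: "x \<in> B" by blast
  have img: "g z \<in> \<Omega>" if "z \<in> B" for z
    using that B block_subset perm by (auto simp: permutes_in_image)
  obtain D where D: "D \<in> \<B>" "g x \<in> D"
    using img[OF x] by (rule obtain_block)
  have "g ` B \<subseteq> D"
  proof
    fix w assume "w \<in> g ` B"
    then obtain y where y: "y \<in> B" "w = g y" by blast
    then obtain D' where "D' \<in> \<B>" "g y \<in> D'"
      using img by (blast elim: obtain_block)
    then show "w \<in> D"
      using same[OF x y(1) D] y(2) by simp
  qed
  moreover have "card (g ` B) = card D"
    using card_image[OF inj_on_subset[OF inj]] card_block B D(1) by simp
  ultimately have "g ` B = D"
    using finite_block[OF D(1)] by (intro card_subset_eq) auto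
  with D show ?thesis by simp
qed

lemma type_code_imprimitive_nt:
  fixes I J :: "nat multiset"
  defines "C \<equiv> {\<alpha>. \<alpha> \<subseteq> \<Omega> \<and> iota \<B> \<alpha> = I}"
  assumes card_\<Omega>: "card \<Omega> = 2 * k + 1" and "k \<ge> 2"
    and ab: "a * b = 2 * k + 1" "a \<ge> 2" "b \<ge> 2" "card \<B> = a"
    and I: "size I = a" "sum_mset I = k" "\<forall>t\<in>#I. t \<le> b"
    and uv: "{#u, v#} \<subseteq># I" "0 < u" "v < b" "u \<noteq> v + 1"
    and J: "J \<noteq> I" "t\<^sub>0 \<in># I" "t\<^sub>0 < b" "neighbour_type b I t\<^sub>0 = J"
      "\<And>t. \<lbrakk>t \<in># I; t < b\<rbrakk> \<Longrightarrow> neighbour_type b I t \<in> {I, J}"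
  shows "imprimitive_nt_code \<Omega> k C a b \<B>"
    and "min_distance \<Omega> k C = 1 \<longleftrightarrow> (\<exists>t\<in>#I. t < b \<and> neighbour_type b I t = I)"
    and "min_distance \<Omega> k C \<ge> 2 \<longleftrightarrow> \<not> (\<exists>t\<in>#I. t < b \<and> neighbour_type b I t = I)"
proof -
  have C: "C \<subseteq> kneser_verts \<Omega> k"
    using I(2) by (auto simp: C_def kneser_verts_def sum_mset_iota[symmetric])
  have aut: "g \<in> code_aut \<Omega> C" if "g permutes \<Omega>" "\<forall>B\<in>\<B>. g ` B \<in> \<B>" for g
  proof -
    \<comment> \<open>Inclusion suffices, since an injective map of a finite set into itself is
      onto.\<close>
    have "(`) g ` C \<subseteq> C"
      using iota_image[OF that] permutes_image[OF that(1)] by (auto simp: C_def)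
    moreover have "finite C"
      using finite by (simp add: C_def)
    moreover have "inj_on ((`) g) C"
      using permutes_inj[OF that(1)] by (meson inj_image_eq_iff inj_onI)
    ultimately show ?thesis
      using that(1) by (simp add: code_aut_def endo_inj_surj)
  qed
  have orbit: "\<exists>g\<in>code_aut \<Omega> C. g ` \<alpha> = \<beta>"
    if "\<alpha> \<subseteq> \<Omega>" "\<beta> \<subseteq> \<Omega>" "iota \<B> \<alpha> = iota \<B> \<beta>" for \<alpha> \<beta>
    using ex_block_perm_mapping[OF that] aut by blast
  have trans_\<Omega>: "\<exists>g\<in>code_aut \<Omega> C. g x = y" if "x \<in> \<Omega>" "y \<in> \<Omega>" for x y
    using orbit[of "{x}" "{y}"] iota_singleton_eq that by auto
  have "\<exists>D\<in>\<B>. \<exists>D'\<in>\<B>. D \<noteq> D'"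
  proof (rule ccontr)
    assume "\<not> ?thesis"
    then have "card \<B> \<le> Suc 0"
      using finite_blocks by (intro card_le_Suc0_iff_eq[THEN iffD2]) auto
    with ab show False by simp
  qed
  then obtain D D' where D: "D \<in> \<B>" "D' \<in> \<B>" "D \<noteq> D'" by blast
  then have "D \<noteq> {}" "D' \<noteq> {}"
    using partition by (auto simp: partition_on_def)
  then obtain x y where xy: "x \<in> D" "y \<in> D'" by blast
  obtain \<alpha> where \<alpha>: "\<alpha> \<in> C" "x \<in> \<alpha>" "y \<notin> \<alpha>"
    using ex_set_of_type[OF D xy _ uv(1) I(3) uv(2,3)] I(1) ab by (auto simp: C_def)
  have iota_C: "iota \<B> \<beta> = I" if "\<beta> \<in> C" for \<beta>
    using that by (simp add: C_def)
  have "card C \<ge> 2"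
  proof -
    \<comment> \<open>The image of \<alpha> contains y while \<alpha> does not, which gives a second
      codeword.\<close>
    obtain g where g: "g \<in> code_aut \<Omega> C" "g x = y"
      using trans_\<Omega>[of x y] xy D block_subset by blast
    then have "g ` \<alpha> \<in> C" "y \<in> g ` \<alpha>"
      using \<alpha> by (auto simp: code_aut_def)
    then have "{\<alpha>, g ` \<alpha>} \<subseteq> C" "\<alpha> \<noteq> g ` \<alpha>"
      using \<alpha> by auto
    moreover have "finite C"
      using finite by (simp add: C_def)
    ultimately show ?thesis
      using card_mono[of C "{\<alpha>, g ` \<alpha>}"] by simp
  qed
  have nbr: "iota \<B> \<gamma> = J \<and> \<gamma> \<subseteq> \<Omega>" if "\<gamma> \<in> code_neighbours \<Omega> k C" for \<gamma>
  proof -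
    obtain \<beta> where "\<beta> \<in> C" "\<beta> \<inter> \<gamma> = {}" "\<gamma> \<in> kneser_verts \<Omega> k" "\<gamma> \<notin> C"
      using \<open>\<gamma> \<in> code_neighbours \<Omega> k C\<close> unfolding code_neighbours_eq[OF C] by blast
    moreover from this obtain t where "t \<in># I" "t < b" "iota \<B> \<gamma> = neighbour_type b I t"
      using neighbour_typeE[OF card_\<Omega>, of \<beta> \<gamma>] C iota_C by (metis subsetD)
    moreover have "iota \<B> \<gamma> \<noteq> I" "\<gamma> \<subseteq> \<Omega>"
      using calculation by (auto simp: C_def kneser_verts_def)
    ultimately show ?thesis
      using J(5)[of t] by auto
  qed
  obtain \<gamma> where "\<gamma> \<in> kneser_verts \<Omega> k" "\<alpha> \<inter> \<gamma> = {}" "iota \<B> \<gamma> = J"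
    using ex_neighbour_of_type[OF card_\<Omega>, of \<alpha> t\<^sub>0] C \<alpha>(1) iota_C[OF \<alpha>(1)] J by auto
  then have "code_neighbours \<Omega> k C \<noteq> {}"
    unfolding code_neighbours_eq[OF C] using \<alpha>(1) iota_C J(1) by blast
  moreover have "\<alpha> \<subseteq> \<Omega>" if "\<alpha> \<in> C" for \<alpha>
    using that by (simp add: C_def)
  ultimately have "neighbour_transitive \<Omega> k C"
    unfolding neighbour_transitive_def transitive_on_def
    using orbit nbr iota_C by simp
  moreover have "imprimitivity_system (code_aut \<Omega> C) \<Omega> a b \<B>"
    unfolding imprimitivity_system_def
    using partition ab card_block code_aut_preserves_blocks[OF _ uv(1) I(3) uv(2-4)] I(1)
    by (auto simp: C_def)
  ultimately show "imprimitive_nt_code \<Omega> k C a b \<B>"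
    unfolding imprimitive_nt_code_def transitive_on_def
    using \<open>k \<ge> 2\<close> finite card_\<Omega> ab C \<open>card C \<ge> 2\<close> trans_\<Omega> by simp
  have "(\<exists>\<alpha>\<in>C. \<exists>\<beta>\<in>C. \<alpha> \<noteq> \<beta> \<and> \<alpha> \<inter> \<beta> = {}) \<longleftrightarrow> (\<exists>t\<in>#I. t < b \<and> neighbour_type b I t = I)"
  proof
    assume "\<exists>\<alpha>\<in>C. \<exists>\<beta>\<in>C. \<alpha> \<noteq> \<beta> \<and> \<alpha> \<inter> \<beta> = {}"
    then show "\<exists>t\<in>#I. t < b \<and> neighbour_type b I t = I"
      using neighbour_typeE[OF card_\<Omega>] C iota_C by (metis subsetD)
  next
    assume "\<exists>t\<in>#I. t < b \<and> neighbour_type b I t = I"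
    then obtain t where "t \<in># I" "t < b" "neighbour_type b I t = I" by blast
    then obtain \<beta> where "\<beta> \<in> kneser_verts \<Omega> k" "\<alpha> \<inter> \<beta> = {}" "iota \<B> \<beta> = I"
      using ex_neighbour_of_type[OF card_\<Omega>, of \<alpha> t] C \<alpha>(1) iota_C[OF \<alpha>(1)] by auto
    moreover from this have "\<beta> \<in> C"
      by (auto simp: C_def kneser_verts_def)
    ultimately show "\<exists>\<alpha>\<in>C. \<exists>\<beta>\<in>C. \<alpha> \<noteq> \<beta> \<and> \<alpha> \<inter> \<beta> = {}"
      using \<alpha> by blast
  qed
  with min_distance_cases[OF C] show
    "min_distance \<Omega> k C = 1 \<longleftrightarrow> (\<exists>t\<in>#I. t < b \<and> neighbour_type b I t = I)"
    "min_distance \<Omega> k C \<ge> 2 \<longleftrightarrow> \<not> (\<exists>t\<in>#I. t < b \<and> neighbour_type b I t = I)"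
    by simp_all
qed

end

section \<open>Codes with three blocks\<close>

lemma interval_block_partition:
  fixes a b :: nat
  assumes "b > 0"
  defines "\<B> \<equiv> (\<lambda>i. {i * b..<(i + 1) * b}) ` {..<a}"
  shows "block_partition {..<a * b} \<B> b" "card \<B> = a"
proof -
  \<comment> \<open>Blocks are the fibres of division by b, which gives both covering and
    disjointness.\<close>
  have mem: "x \<in> {i * b..<(i + 1) * b} \<longleftrightarrow> x div b = i" for x i
    using div_nat_eqI[of b i x] assms(1)
    by (auto simp: mult.commute dividend_less_times_div algebra_simps)
  have "x \<in> \<Union>\<B> \<longleftrightarrow> x div b \<in> {..<a}" for x
    unfolding \<B>_def by (simp only: UN_iff mem) auto
  then have "\<Union>\<B> = {..<a * b}"
    using assms(1) by (auto simp: div_less_iff_less_mult)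
  moreover have "B = B'" if B: "B \<in> \<B>" "B' \<in> \<B>" and x: "x \<in> B" "x \<in> B'" for B B' x
  proof -
    obtain i j where ij: "B = {i * b..<(i + 1) * b}" "B' = {j * b..<(j + 1) * b}"
      using B unfolding \<B>_def by (elim imageE)
    have "x div b = i" "x div b = j"
      using x unfolding ij mem by simp_all
    then show ?thesis by (simp add: ij)
  qed
  moreover have "{} \<notin> \<B>"
    using assms(1) by (auto simp: \<B>_def)
  ultimately have "partition_on {..<a * b} \<B>"
    by (intro partition_onI) (simp, force simp: disjnt_def, blast)
  moreover have "card B = b" if "B \<in> \<B>" for B
    using that by (auto simp: \<B>_def)
  ultimately show "block_partition {..<a * b} \<B> b"
    by unfold_locales simp_all
  have "inj_on (\<lambda>i. {i * b..<(i + 1) * b}) {..<a}"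
  proof (rule inj_onI)
    fix i j assume eq: "{i * b..<(i + 1) * b} = {j * b..<(j + 1) * b}"
    have "i * b \<in> {i * b..<(i + 1) * b}"
      using assms(1) by simp
    then show "i = j"
      unfolding eq mem using assms(1) by simp
  qed
  then show "card \<B> = a"
    by (simp add: \<B>_def card_image)
qed

text \<open>The conditional lets one construction serve all three families: the minimum distance is
  1 exactly when \<open>I\<close> is a neighbour type of itself.\<close>

lemma ex_three_block_code:
  assumes k: "3 * b = 2 * k + 1" "k \<ge> 2" and "b \<ge> 2"
    and I: "size I = 3" "sum_mset I = k" "\<forall>t\<in>#I. t \<le> b"
    and uv: "{#u, v#} \<subseteq># I" "0 < u" "v < b" "u \<noteq> v + 1"
    and J: "J \<noteq> I" "t\<^sub>0 \<in># I" "t\<^sub>0 < b" "neighbour_type b I t\<^sub>0 = J"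
      "\<And>t. \<lbrakk>t \<in># I; t < b\<rbrakk> \<Longrightarrow> neighbour_type b I t \<in> {I, J}"
  shows "\<exists>C \<B>. imprimitive_nt_code {..<2 * k + 1 :: nat} k C 3 b \<B> \<and> (\<forall>\<alpha>\<in>C. iota \<B> \<alpha> = I) \<and>
    (if \<exists>t\<in>#I. t < b \<and> neighbour_type b I t = I then min_distance {..<2 * k + 1} k C = 1
     else min_distance {..<2 * k + 1} k C \<ge> 2)"
proof -
  let ?\<B> = "(\<lambda>i. {i * b..<(i + 1) * b}) ` {..<3}"
  have "b > 0" using assms(3) by simp
  interpret block_partition "{..<2 * k + 1}" ?\<B> b
    using interval_block_partition(1)[OF \<open>b > 0\<close>, of 3] k(1) by simp
  have "card ?\<B> = 3"
    using interval_block_partition(2)[OF \<open>b > 0\<close>, of 3] by simp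
  note code = type_code_imprimitive_nt[OF _ k(2,1) _ \<open>b \<ge> 2\<close> this I uv J]
  show ?thesis
    by (rule exI[of _ "{\<alpha>. \<alpha> \<subseteq> {..<2 * k + 1} \<and> iota ?\<B> \<alpha> = I}"], rule exI[of _ ?\<B>])
      (use code in simp)
qed

lemma ex_full_or_const_code:
  assumes "c > 0"
  defines "k \<equiv> 6 * c + 1"
  shows "\<exists>C a b \<B>. imprimitive_nt_code {..<2 * k + 1 :: nat} k C a b \<B> \<and>
    full_or_const_type {..<2 * k + 1} k C b \<B>"
proof -
  let ?b = "4 * c + 1"
  let ?I = "{#?b, c, c#}" and ?J = "{#3 * c, 3 * c + 1, 0#}"
  \<comment> \<open>The only entry below b is c, so \<open>?J\<close> is the only neighbour type. It
    lacks the entry b, so it differs from \<open>?I\<close> and the distance is at least 2.\<close>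
  have nt: "neighbour_type ?b ?I c = ?J"
    using assms by (simp add: neighbour_type_def)
  have "?b \<notin># ?J"
    using assms by simp
  then have "?J \<noteq> ?I"
    by (metis union_single_eq_member)
  then obtain C \<B> where C: "imprimitive_nt_code {..<2 * k + 1 :: nat} k C 3 ?b \<B>"
      "\<forall>\<alpha>\<in>C. iota \<B> \<alpha> = ?I" "min_distance {..<2 * k + 1} k C \<ge> 2"
    using ex_three_block_code[of ?b k ?I c c ?J c] nt assms by (auto split: if_splits)
  have "?I = replicate_mset 1 ?b + replicate_mset 2 c"
    by (simp add: numeral_2_eq_2)
  with C have "full_or_const_type {..<2 * k + 1} k C ?b \<B>"
    unfolding full_or_const_type_def by metis
  with C(1) show ?thesis by blast
qed

lemma ex_balanced_code:
  assumes "m > 0"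
  defines "k \<equiv> 3 * m + 1"
  shows "\<exists>C a b \<B>. imprimitive_nt_code {..<2 * k + 1 :: nat} k C a b \<B> \<and>
    balanced_type {..<2 * k + 1} k C a b \<B>"
proof -
  let ?b = "2 * m + 1"
  let ?I = "{#m, m, m + 1#}" and ?J = "{#m - 1, m + 1, m + 1#}"
  \<comment> \<open>The value m gives distance 1 and m + 1 gives the neighbours outside the code.
    Below, u = v = m is chosen, because u = m + 1, v = m would violate u \<noteq> v + 1.\<close>
  have nt: "neighbour_type ?b ?I m = ?I" "neighbour_type ?b ?I (m + 1) = ?J"
    using assms by (simp_all add: neighbour_type_def)
  have "m \<notin># ?J"
    using assms by simp
  then have "?J \<noteq> ?I"
    by (metis union_single_eq_member)
  then obtain C \<B> where C: "imprimitive_nt_code {..<2 * k + 1 :: nat} k C 3 ?b \<B>"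
      "\<forall>\<alpha>\<in>C. iota \<B> \<alpha> = ?I" "min_distance {..<2 * k + 1} k C = 1"
    using ex_three_block_code[of ?b k ?I m m ?J "m + 1"] nt assms by (auto split: if_splits)
  have "replicate_mset 2 m = {#m, m#}"
    by (simp add: numeral_2_eq_2)
  then have "?I = replicate_mset ((3 + 1) div 2) ((?b - 1) div 2) +
      replicate_mset ((3 - 1) div 2) ((?b + 1) div 2)"
    by simp
  with C have "balanced_type {..<2 * k + 1} k C 3 ?b \<B>"
    unfolding balanced_type_def by metis
  with C(1) show ?thesis by blast
qed

lemma ex_empty_or_full_code:
  assumes "m > 0"
  defines "k \<equiv> 3 * m + 1"
  shows "\<exists>C a b \<B>. imprimitive_nt_code {..<2 * k + 1 :: nat} k C a b \<B> \<and>
    empty_or_full_type {..<2 * k + 1} k C a b \<B>"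
proof -
  let ?b = "2 * m + 1"
  let ?I = "{#0, m, ?b#}" and ?J = "{#2 * m, m + 1, 0#}"
  \<comment> \<open>Here m gives distance 1 and 0 the outer neighbours. The pair u = b, v = 0 is
    admissible since m > 0 makes b differ from 1.\<close>
  have nt: "neighbour_type ?b ?I m = ?I" "neighbour_type ?b ?I 0 = ?J"
    using assms by (simp_all add: neighbour_type_def add_mset_commute)
  have "?b \<notin># ?J"
    using assms by simp
  then have "?J \<noteq> ?I"
    by (metis union_single_eq_member add_mset_commute)
  then obtain C \<B> where C: "imprimitive_nt_code {..<2 * k + 1 :: nat} k C 3 ?b \<B>"
      "\<forall>\<alpha>\<in>C. iota \<B> \<alpha> = ?I" "min_distance {..<2 * k + 1} k C = 1"
    using ex_three_block_code[of ?b k ?I ?b 0 ?J 0] nt assms by (auto split: if_splits)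
  have "?I = replicate_mset ((3 - 1) div 2) 0 + {#(?b - 1) div 2#} + replicate_mset ((3 - 1) div 2) ?b"
    by simp
  with C have "empty_or_full_type {..<2 * k + 1} k C 3 ?b \<B>"
    unfolding empty_or_full_type_def by metis
  with C(1) show ?thesis by blast
qed

text \<open>An infinite family is taken to mean infinitely many k; distinct positive m give distinct
  values d * m + 1.\<close>

lemma infinite_nat_progression:
  fixes P :: "nat \<Rightarrow> bool"
  assumes "\<And>m. m > 0 \<Longrightarrow> P (d * m + 1)" "d > 0"
  shows "infinite {k. P k}"
proof -
  have "inj (\<lambda>m. d * Suc m + 1)"
    using assms(2) by (auto simp: inj_def)
  then have "infinite (range (\<lambda>m. d * Suc m + 1))"
    by (rule range_inj_infinite)
  moreover have "range (\<lambda>m. d * Suc m + 1) \<subseteq> {k. P k}"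
    using assms(1)[of "Suc _"] by blast
  ultimately show ?thesis
    using infinite_super by blast
qed

theorem theorem1p6:
  "(\<forall>(\<Omega> :: 'a set) k C a b \<B>. imprimitive_nt_code \<Omega> k C a b \<B> \<longrightarrow>
      full_or_const_type \<Omega> k C b \<B> \<or>
      balanced_type \<Omega> k C a b \<B> \<or>
      empty_or_full_type \<Omega> k C a b \<B>) \<and>
   infinite {k. \<exists>C a b \<B>. imprimitive_nt_code {..<2 * k + 1 :: nat} k C a b \<B> \<and>
      full_or_const_type {..<2 * k + 1} k C b \<B>} \<and>
   infinite {k. \<exists>C a b \<B>. imprimitive_nt_code {..<2 * k + 1 :: nat} k C a b \<B> \<and>
      balanced_type {..<2 * k + 1} k C a b \<B>} \<and>
   infinite {k. \<exists>C a b \<B>. imprimitive_nt_code {..<2 * k + 1 :: nat} k C a b \<B> \<and>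
      empty_or_full_type {..<2 * k + 1} k C a b \<B>}"
proof (intro conjI)
  show "infinite {k. \<exists>C a b \<B>. imprimitive_nt_code {..<2 * k + 1 :: nat} k C a b \<B> \<and>
      full_or_const_type {..<2 * k + 1} k C b \<B>}"
    by (rule infinite_nat_progression[where d = 6], rule ex_full_or_const_code) simp_all
  show "infinite {k. \<exists>C a b \<B>. imprimitive_nt_code {..<2 * k + 1 :: nat} k C a b \<B> \<and>
      balanced_type {..<2 * k + 1} k C a b \<B>}"
    by (rule infinite_nat_progression[where d = 3], rule ex_balanced_code) simp_all
  show "infinite {k. \<exists>C a b \<B>. imprimitive_nt_code {..<2 * k + 1 :: nat} k C a b \<B> \<and>
      empty_or_full_type {..<2 * k + 1} k C a b \<B>}"
    by (rule infinite_nat_progression[where d = 3], rule ex_empty_or_full_code) simp_all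
qed (intro allI impI imprimitive_nt_code_classification)

end
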